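(* Let $f\colon\mathbb{R}^n\to\mathbb{R}$ be $\beta$-smooth and $\alpha$-strongly convex with $0<\alpha\le\beta$, and let $x_0\in\mathbb{R}^n$. Given the same initial point $x_0$, the Optimal Quadratic Averaging algorithm and the Geometric Descent algorithm (both described in the context) produce the same iterates $x_k$ and $c_k$. Moreover, $$v_k=f(x_k^+)-\frac{\alpha}{2}R_k^2,$$ where $v_k$ is the minimum value of the quadratic $Q_k$ in the Optimal Quadratic Averaging algorithm and $R_k$ is the radius of the ball in the Geometric Descent algorithm.
   Context: The norm $\|\cdot\|$ is Euclidean, and $B(x,R^2)$ denotes the Euclidean ball of radius $R$ (squared radius $R^2$) around $x$. "$f$ is $\beta$-smooth and $\alpha$-strongly convex" means $f$ is differentiable and for all $x,y\in\mathbb{R}^n$ $$f(x)+\langle\nabla f(x),y-x\rangle+\tfrac{\alpha}{2}\|y-x\|^2\le f(y)\le f(x)+\langle\nabla f(x),y-x\rangle+\tfrac{\beta}{2}\|y-x\|^2 .$$ For $x\in\mathbb{R}^n$ put $x^+:=x-\frac1\beta\nabla f(x)$ and $x^{++}:=x-\frac1\alpha\nabla f(x)$. For $x,y\in\mathbb{R}^n$, $\mathrm{line\_search}(x,y)$ denotes the minimizer of $f$ on the line $\{x+t(y-x):t\in\mathbb{R}\}$ through $x$ and $y$. Optimal averaging of two quadratics: given $Q_A(x)=v_A+\frac{\alpha}{2}\|x-x_A\|^2$ and $Q_B(x)=v_B+\frac{\alpha}{2}\|x-x_B\|^2$, for each $\lambda\in[0,1]$ the average $\lambda Q_A+(1-\lambda)Q_B$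 has the form $v_\lambda+\frac{\alpha}{2}\|\cdot-c_\lambda\|^2$ with $c_\lambda=\lambda x_A+(1-\lambda)x_B$ and $v_\lambda=v_B+\left(v_A-v_B+\frac\alpha2\|x_A-x_B\|^2\right)\lambda-\frac\alpha2\|x_A-x_B\|^2\lambda^2$. The optimal averaging of $Q_A$ and $Q_B$ is $\bar v+\frac{\alpha}{2}\|\cdot-\bar c\|^2$ with $\bar v=v_{\bar\lambda}$, $\bar c=c_{\bar\lambda}$, where $\bar\lambda$ is the choice of $\lambda\in[0,1]$ maximizing $v_\lambda$, namely the projection onto $[0,1]$ of $\frac12+\frac{v_A-v_B}{\alpha\|x_A-x_B\|^2}$. Optimal Quadratic Averaging algorithm: set $v_0=f(x_0)-\frac{\|\nabla f(x_0)\|^2}{2\alpha}$, $c_0=x_0^{++}$ and $Q_0(x)=v_0+\frac\alpha2\|x-c_0\|^2$. For $k=1,2,\dots$: set $x_k=\mathrm{line\_search}(c_{k-1},x_{k-1}^+)$; set $Q(x)=\left(f(x_k)-\frac{\|\nabla f(x_k)\|^2}{2\alpha}\right)+\frac\alpha2\|x-x_k^{++}\|^2$; let $Q_k(x)=v_k+\frac\alpha2\|x-c_k\|^2$ be the optimal averaging of $Q$ and $Q_{k-1}$. Geometric Descent algorithm: set $c_0=x_0^{++}$ and $R_0^2=\frac{\|\nabla f(x_0)\|^2}{\alpha^2}-\frac2\alpha\left(f(x_0)-f(x_0^+)\right)$. For $k=1,2,\dots$: set $x_k=\mathrm{line\_search}(x_{k-1}^+,c_{k-1})$; set $x_A=x_k-\alpha^{-1}\nabla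 f(x_k)$ and $R_A^2=\frac{\|\nabla f(x_k)\|^2}{\alpha^2}-\frac2\alpha\left(f(x_k)-f(x_k^+)\right)$; set $x_B=c_{k-1}$ and $R_B^2=R_{k-1}^2-\frac2\alpha\left(f(x_{k-1}^+)-f(x_k^+)\right)$; let $B(c_k,R_k^2)$ be the smallest enclosing ball (the ball of smallest radius containing the set) of $B(x_A,R_A^2)\cap B(x_B,R_B^2)$. *)

theory Defs
  imports "HOL-Analysis.Analysis"
begin

definition grad :: "('a::real_inner \<Rightarrow> real) \<Rightarrow> 'a \<Rightarrow> 'a" where
  "grad f x = (THE g. GDERIV f x :> g)"

definition smooth_strongly_convex ::
    "real \<Rightarrow> real \<Rightarrow> ('a::euclidean_space \<Rightarrow> real) \<Rightarrow> bool" where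
  "smooth_strongly_convex \<beta> \<alpha> f \<longleftrightarrow>
     (\<forall>x. f differentiable (at x)) \<and>
     (\<forall>x y. f x + grad f x \<bullet> (y - x) + \<alpha> / 2 * (norm (y - x))\<^sup>2 \<le> f y \<and>
            f y \<le> f x + grad f x \<bullet> (y - x) + \<beta> / 2 * (norm (y - x))\<^sup>2)"

definition short_step :: "('a::euclidean_space \<Rightarrow> real) \<Rightarrow> real \<Rightarrow> 'a \<Rightarrow> 'a" where
  "short_step f \<beta> x = x - (1 / \<beta>) *\<^sub>R grad f x"  (* x^+ *)

definition long_step :: "('a::euclidean_space \<Rightarrow> real) \<Rightarrow> real \<Rightarrow> 'a \<Rightarrow> 'a" where
  "long_step f \<alpha> x = x - (1 / \<alpha>) *\<^sub>R grad f x"  (* x^{++} *)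

definition line_search :: "('a::euclidean_space \<Rightarrow> real) \<Rightarrow> 'a \<Rightarrow> 'a \<Rightarrow> 'a" where
  "line_search f x y = arg_min_on f (range (\<lambda>t::real. x + t *\<^sub>R (y - x)))"


subsection \<open>Optimal quadratic averaging\<close>

text \<open>The curvature \<open>\<alpha>\<close> being fixed, a quadratic \<open>v + \<alpha>/2 \<parallel>x - c\<parallel>\<^sup>2\<close> is represented by the pair
  \<open>(v, c)\<close> of its minimum value and its minimizer.\<close>

definition quad :: "real \<Rightarrow> real \<times> 'a::euclidean_space \<Rightarrow> 'a \<Rightarrow> real" where
  "quad \<alpha> Q x = fst Q + \<alpha> / 2 * (norm (x - snd Q))\<^sup>2"

definition avg_center :: "'a::euclidean_space \<Rightarrow> 'a \<Rightarrow> real \<Rightarrow> 'a" where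
  "avg_center x\<^sub>A x\<^sub>B l = l *\<^sub>R x\<^sub>A + (1 - l) *\<^sub>R x\<^sub>B"

definition avg_value :: "real \<Rightarrow> real \<times> 'a::euclidean_space \<Rightarrow> real \<times> 'a \<Rightarrow> real \<Rightarrow> real" where
  "avg_value \<alpha> A B l =
     fst B + (fst A - fst B + \<alpha> / 2 * (norm (snd A - snd B))\<^sup>2) * l
           - \<alpha> / 2 * (norm (snd A - snd B))\<^sup>2 * l\<^sup>2"

lemma quad_average:
  "l * quad \<alpha> A x + (1 - l) * quad \<alpha> B x =
     quad \<alpha> (avg_value \<alpha> A B l, avg_center (snd A) (snd B) l) x"
  unfolding quad_def avg_value_def avg_center_def power2_norm_eq_inner fst_conv snd_conv
  by (simp add: inner_diff_left inner_diff_right inner_add_left inner_add_right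
      inner_commute field_simps power2_eq_square)

text \<open>The maximizer is unique unless \<open>A = B\<close>, and in that case every \<open>l\<close> gives the same average.
  The closed form for the maximizer (projecting \<open>1/2 + (v\<^sub>A - v\<^sub>B) / (\<alpha> \<parallel>x\<^sub>A - x\<^sub>B\<parallel>\<^sup>2)\<close> onto
  \<open>[0,1]\<close>) is not used as the definition, because it is meaningless for \<open>x\<^sub>A = x\<^sub>B\<close>.\<close>

definition optimal_averaging ::
    "real \<Rightarrow> real \<times> 'a::euclidean_space \<Rightarrow> real \<times> 'a \<Rightarrow> real \<times> 'a" where
  "optimal_averaging \<alpha> A B =
     (let l = arg_max_on (avg_value \<alpha> A B) {0..1}
      in (avg_value \<alpha> A B l, avg_center (snd A) (snd B) l))"

definition lower_quad :: "('a::euclidean_space \<Rightarrow> real) \<Rightarrow> real \<Rightarrow> 'a \<Rightarrow> real \<times> 'a" where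
  "lower_quad f \<alpha> x = (f x - (norm (grad f x))\<^sup>2 / (2 * \<alpha>), long_step f \<alpha> x)"

text \<open>State after step \<open>k\<close>: \<open>(x\<^sub>k, v\<^sub>k, c\<^sub>k)\<close>; the last two components represent \<open>Q\<^sub>k\<close>.\<close>

primrec oqa ::
    "('a::euclidean_space \<Rightarrow> real) \<Rightarrow> real \<Rightarrow> real \<Rightarrow> 'a \<Rightarrow> nat \<Rightarrow> 'a \<times> real \<times> 'a" where
  "oqa f \<alpha> \<beta> x\<^sub>0 0 = (x\<^sub>0, lower_quad f \<alpha> x\<^sub>0)"
| "oqa f \<alpha> \<beta> x\<^sub>0 (Suc k) =
     (let (x, v, c) = oqa f \<alpha> \<beta> x\<^sub>0 k;
          x' = line_search f c (short_step f \<beta> x)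
      in (x', optimal_averaging \<alpha> (lower_quad f \<alpha> x') (v, c)))"

definition oqa_x where "oqa_x f \<alpha> \<beta> x\<^sub>0 k = fst (oqa f \<alpha> \<beta> x\<^sub>0 k)"
definition oqa_v where "oqa_v f \<alpha> \<beta> x\<^sub>0 k = fst (snd (oqa f \<alpha> \<beta> x\<^sub>0 k))"
definition oqa_c where "oqa_c f \<alpha> \<beta> x\<^sub>0 k = snd (snd (oqa f \<alpha> \<beta> x\<^sub>0 k))"


subsection \<open>Geometric descent\<close>

text \<open>The closed ball \<open>B(x, s)\<close> of squared radius \<open>s\<close>. For \<open>s < 0\<close> it is empty, since then
  \<open>sqrt s < 0\<close>.\<close>

definition sq_ball :: "'a::euclidean_space \<Rightarrow> real \<Rightarrow> 'a set" where
  "sq_ball x s = cball x (sqrt s)"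

definition is_smallest_enclosing_ball :: "'a::euclidean_space set \<Rightarrow> 'a \<Rightarrow> real \<Rightarrow> bool" where
  "is_smallest_enclosing_ball S c r \<longleftrightarrow>
     0 \<le> r \<and> S \<subseteq> cball c r \<and> (\<forall>c' r'. 0 \<le> r' \<longrightarrow> S \<subseteq> cball c' r' \<longrightarrow> r \<le> r')"

text \<open>Center and radius; determined for every nonempty bounded set.\<close>

definition smallest_enclosing_ball :: "'a::euclidean_space set \<Rightarrow> 'a \<times> real" where
  "smallest_enclosing_ball S = (THE (c, r). is_smallest_enclosing_ball S c r)"

definition gd_sq_radius :: "('a::euclidean_space \<Rightarrow> real) \<Rightarrow> real \<Rightarrow> real \<Rightarrow> 'a \<Rightarrow> real" where
  "gd_sq_radius f \<alpha> \<beta> x =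
     (norm (grad f x))\<^sup>2 / \<alpha>\<^sup>2 - 2 / \<alpha> * (f x - f (short_step f \<beta> x))"

text \<open>State after step \<open>k\<close>: \<open>(x\<^sub>k, c\<^sub>k, R\<^sub>k)\<close>, where \<open>R\<^sub>k\<close> is the radius itself, not its square.\<close>

primrec geometric_descent ::
    "('a::euclidean_space \<Rightarrow> real) \<Rightarrow> real \<Rightarrow> real \<Rightarrow> 'a \<Rightarrow> nat \<Rightarrow> 'a \<times> 'a \<times> real" where
  "geometric_descent f \<alpha> \<beta> x\<^sub>0 0 = (x\<^sub>0, long_step f \<alpha> x\<^sub>0, sqrt (gd_sq_radius f \<alpha> \<beta> x\<^sub>0))"
| "geometric_descent f \<alpha> \<beta> x\<^sub>0 (Suc k) =
     (let (x, c, R) = geometric_descent f \<alpha> \<beta> x\<^sub>0 k;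
          x' = line_search f (short_step f \<beta> x) c;
          x\<^sub>A = long_step f \<alpha> x';
          sA = gd_sq_radius f \<alpha> \<beta> x';
          x\<^sub>B = c;
          sB = R\<^sup>2 - 2 / \<alpha> * (f (short_step f \<beta> x) - f (short_step f \<beta> x'))
      in (x', smallest_enclosing_ball (sq_ball x\<^sub>A sA \<inter> sq_ball x\<^sub>B sB)))"

definition gd_x where "gd_x f \<alpha> \<beta> x\<^sub>0 k = fst (geometric_descent f \<alpha> \<beta> x\<^sub>0 k)"
definition gd_c where "gd_c f \<alpha> \<beta> x\<^sub>0 k = fst (snd (geometric_descent f \<alpha> \<beta> x\<^sub>0 k))"
definition gd_R where "gd_R f \<alpha> \<beta> x\<^sub>0 k = snd (snd (geometric_descent f \<alpha> \<beta> x\<^sub>0 k))"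

end

theory Submission
  imports Defs
begin

text \<open>
  Both algorithms carry the same lower bounds on \<open>f\<close>. At step \<open>k\<close> put \<open>u = f x\<^sub>k\<^sup>+\<close>. The two balls
  that geometric descent intersects are exactly the sublevel sets at height \<open>u\<close> of the two
  quadratics that quadratic averaging combines (for the second one, this is the invariant
  \<open>v\<^sub>k = f x\<^sub>k\<^sup>+ - \<alpha>/2 R\<^sub>k\<^sup>2\<close> of the preceding step). Hence one step of the equivalence amounts to a
  statement about two quadratics \<open>Q\<^sub>A\<close>, \<open>Q\<^sub>B\<close> of equal curvature: the smallest ball enclosing
  \<open>{Q\<^sub>A \<le> u} \<inter> {Q\<^sub>B \<le> u}\<close> is the sublevel set at height \<open>u\<close> of their optimal average
  (\<open>smallest_enclosing_ball_optimal_averaging\<close>). That set encloses the intersection because an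
  average of two numbers below \<open>u\<close> is below \<open>u\<close>. No smaller ball does, since the intersection
  contains two antipodal points \<open>c + e\<close>, \<open>c - e\<close> of its boundary: optimality of the weight gives
  \<open>Q\<^sub>A c \<le> v\<close> and \<open>Q\<^sub>B c \<le> v\<close> (\<open>optimal_averaging_saddle\<close>), and moving from \<open>c\<close> orthogonally to
  the line of centers raises \<open>Q\<^sub>A\<close>, \<open>Q\<^sub>B\<close> and their average by the same amount. The intersection
  is nonempty because it contains \<open>x\<^sub>k\<^sup>+\<close>: all the quadratics are lower bounds of \<open>f\<close>.

  An orthogonal direction exists in dimension at least two only, and on the line the claim about
  balls fails: two partially overlapping intervals can meet in an interval shorter than the averaged
  sublevel set. There the algorithm itself helps. The first line search already explores all of
  \<open>\<real>\<close>, unless \<open>c\<^sub>0 = x\<^sub>0\<^sup>+\<close>, in which case that point minimizes \<open>f\<close>. So all later iterates are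
  the minimizer of \<open>f\<close> (\<open>oqa_critical_1D\<close>), the ball around \<open>x\<^sub>k\<^sup>+\<^sup>+\<close> has radius zero, and \<open>e = 0\<close>
  serves.
\<close>

section \<open>Optimal averages of quadratics\<close>

text \<open>The slope of the concave parabola \<open>avg_value \<alpha> A B\<close> at \<open>l\<close> is \<open>Q\<^sub>A c - Q\<^sub>B c\<close>, where \<open>c\<close> is the
  center at \<open>l\<close>, while \<open>l Q\<^sub>A c + (1 - l) Q\<^sub>B c\<close> is its value there. If \<open>l\<close> is a maximizer on \<open>[0,1]\<close>,
  this slope cannot point into the interval, and so neither \<open>Q\<^sub>A c\<close> nor \<open>Q\<^sub>B c\<close> exceeds the maximum.
  Thus \<open>(l, c)\<close> is a saddle point of \<open>l Q\<^sub>A x + (1 - l) Q\<^sub>B x\<close>.\<close>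

lemma optimal_averaging_saddle:
  fixes A B :: "real \<times> 'a::euclidean_space"
  assumes "0 < \<alpha>"
  obtains l where "0 \<le> l" "l \<le> 1"
    and "optimal_averaging \<alpha> A B = (avg_value \<alpha> A B l, avg_center (snd A) (snd B) l)"
    and "\<And>m. 0 \<le> m \<Longrightarrow> m \<le> 1 \<Longrightarrow> avg_value \<alpha> A B m \<le> avg_value \<alpha> A B l"
    and "quad \<alpha> A (avg_center (snd A) (snd B) l) \<le> avg_value \<alpha> A B l"
    and "quad \<alpha> B (avg_center (snd A) (snd B) l) \<le> avg_value \<alpha> A B l"
proof -
  define l where "l = arg_max_on (avg_value \<alpha> A B) {0..1}"
  define D where "D = \<alpha> / 2 * (norm (snd A - snd B))\<^sup>2"
  define c where "c = avg_center (snd A) (snd B) l"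
  have v: "avg_value \<alpha> A B m = fst B + (fst A - fst B + D) * m - D * m\<^sup>2" for m
    by (simp add: avg_value_def D_def)
  have "continuous_on {0..1} (avg_value \<alpha> A B)"
    unfolding avg_value_def by (intro continuous_intros)
  then have "\<exists>m0\<in>{0..1}. \<forall>m\<in>{0..1}. avg_value \<alpha> A B m \<le> avg_value \<alpha> A B m0"
    by (intro continuous_attains_sup) auto
  then obtain m0 where "m0 \<in> {0..1}" "\<forall>m\<in>{0..1}. avg_value \<alpha> A B m \<le> avg_value \<alpha> A B m0"
    by blast
  then have "is_arg_max (avg_value \<alpha> A B) (\<lambda>m. m \<in> {0..1}) m0"
    by (auto simp: is_arg_max_linorder)
  then have "is_arg_max (avg_value \<alpha> A B) (\<lambda>m. m \<in> {0..1}) l"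
    unfolding l_def arg_max_on_def arg_max_def by (rule someI)
  then have l: "0 \<le> l" "l \<le> 1"
    and max: "\<And>m. 0 \<le> m \<Longrightarrow> m \<le> 1 \<Longrightarrow> avg_value \<alpha> A B m \<le> avg_value \<alpha> A B l"
    by (auto simp: is_arg_max_linorder)
  have "c - snd A = (1 - l) *\<^sub>R (snd B - snd A)" "c - snd B = l *\<^sub>R (snd A - snd B)"
    by (simp_all add: c_def avg_center_def algebra_simps)
  then have QA: "quad \<alpha> A c = fst A + D * (1 - l)\<^sup>2" and QB: "quad \<alpha> B c = fst B + D * l\<^sup>2"
    by (simp_all add: quad_def D_def power_mult_distrib norm_minus_commute)
  \<comment> \<open>the derivative of \<open>avg_value \<alpha> A B\<close> at \<open>l\<close>\<close>
  define s where "s = quad \<alpha> A c - quad \<alpha> B c"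
  have expand: "avg_value \<alpha> A B m - avg_value \<alpha> A B l = (m - l) * s - D * (m - l)\<^sup>2" for m
    unfolding s_def v QA QB by (simp add: algebra_simps power2_eq_square)
  have feasible_slope: "(m - l) * s \<le> 0" if m: "0 \<le> m" "m \<le> 1" for m
  proof (rule ccontr)
    assume "\<not> (m - l) * s \<le> 0"
    then have pos: "(m - l) * s > 0" by simp
    define K where "K = D * (m - l)\<^sup>2"
    have "K \<ge> 0" using assms by (simp add: K_def D_def)
    \<comment> \<open>Moving the fraction \<open>t\<close> of the way to \<open>m\<close> gains \<open>t (m - l) s - t\<^sup>2 K\<close>; this \<open>t\<close> is at most
      one and makes the gain positive.\<close>
    define t where "t = (m - l) * s / ((m - l) * s + K)"
    have t: "0 < t" "t \<le> 1" using pos \<open>K \<ge> 0\<close> by (simp_all add: t_def)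
    have "l + t * (m - l) = (1 - t) * l + t * m" by (simp add: algebra_simps)
    then have "0 \<le> l + t * (m - l)" using t l m by simp
    moreover have "(1 - t) * l + t * m \<le> 1"
      using convex_bound_le[of l 1 m "1 - t" t] t l m by simp
    ultimately have "avg_value \<alpha> A B (l + t * (m - l)) - avg_value \<alpha> A B l \<le> 0"
      using max \<open>l + t * (m - l) = (1 - t) * l + t * m\<close> by simp
    then have "t * ((m - l) * s) - t\<^sup>2 * K \<le> 0"
      unfolding expand by (simp add: K_def power_mult_distrib mult_ac)
    then have "t * ((m - l) * s - t * K) \<le> 0"
      by (simp add: algebra_simps power2_eq_square)
    then have "(m - l) * s \<le> t * K"
      using t by (simp add: mult_le_0_iff)
    moreover have "t * ((m - l) * s) + t * K = (m - l) * s"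
      using pos \<open>K \<ge> 0\<close> by (simp add: t_def add_divide_distrib[symmetric] ring_distribs[symmetric])
    moreover have "t * ((m - l) * s) > 0" using t pos by simp
    ultimately show False by linarith
  qed
  have "quad \<alpha> A c - avg_value \<alpha> A B l = (1 - l) * s"
    "quad \<alpha> B c - avg_value \<alpha> A B l = (0 - l) * s"
    unfolding s_def v QA QB by (simp_all add: algebra_simps power2_eq_square)
  then have "quad \<alpha> A c \<le> avg_value \<alpha> A B l" "quad \<alpha> B c \<le> avg_value \<alpha> A B l"
    using feasible_slope[of 1] feasible_slope[of 0] by simp_all
  moreover have "optimal_averaging \<alpha> A B = (avg_value \<alpha> A B l, c)"
    by (simp add: optimal_averaging_def Let_def l_def c_def)
  ultimately show thesis using that l max unfolding c_def by blast
qed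

lemma optimal_averaging_le:
  assumes "0 < \<alpha>" and "quad \<alpha> A y \<le> u" and "quad \<alpha> B y \<le> u"
  shows "quad \<alpha> (optimal_averaging \<alpha> A B) y \<le> u"
proof -
  obtain l where l: "0 \<le> l" "l \<le> 1"
    and opt: "optimal_averaging \<alpha> A B = (avg_value \<alpha> A B l, avg_center (snd A) (snd B) l)"
    using optimal_averaging_saddle[OF assms(1)] by metis
  have "l * quad \<alpha> A y + (1 - l) * quad \<alpha> B y \<le> u"
    using convex_bound_le[OF assms(2,3)] l by simp
  then show ?thesis unfolding opt quad_average .
qed

section \<open>Smallest enclosing balls\<close>

lemma mem_sq_ball: "p \<in> sq_ball x s \<longleftrightarrow> (norm (p - x))\<^sup>2 \<le> s"
proof
  assume "p \<in> sq_ball x s"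
  then have "norm (p - x) \<le> sqrt s"
    by (simp add: sq_ball_def dist_norm norm_minus_commute)
  moreover from this have "0 \<le> sqrt s" using norm_ge_zero order_trans by blast
  ultimately show "(norm (p - x))\<^sup>2 \<le> s"
    by (metis power_mono norm_ge_zero real_sqrt_ge_0_iff real_sqrt_pow2)
qed (simp add: sq_ball_def dist_norm norm_minus_commute real_le_rsqrt)

lemma quad_sublevel:
  assumes "0 < \<alpha>"
  shows "{y. quad \<alpha> Q y \<le> u} = sq_ball (snd Q) (2 / \<alpha> * (u - fst Q))"
  using assms by (auto simp: mem_sq_ball quad_def field_simps)

text \<open>By the parallelogram law, a ball with center \<open>c'\<close> and radius \<open>r'\<close> that contains both \<open>c + e\<close>
  and \<open>c - e\<close> satisfies \<open>\<parallel>c - c'\<parallel>\<^sup>2 + \<parallel>e\<parallel>\<^sup>2 \<le> r'\<^sup>2\<close>. This gives minimality and, which the definite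
  description requires, uniqueness.\<close>

lemma smallest_enclosing_ball_antipodal:
  assumes "S \<subseteq> cball c (norm e)" and "c + e \<in> S" and "c - e \<in> S"
  shows "smallest_enclosing_ball S = (c, norm e)"
proof -
  have bound: "(norm (c - c'))\<^sup>2 + (norm e)\<^sup>2 \<le> r'\<^sup>2" if "S \<subseteq> cball c' r'" "0 \<le> r'" for c' r'
  proof -
    have "norm (c - c' + e) = dist (c + e) c'" "norm (c - c' - e) = dist (c - e) c'"
      by (simp_all add: dist_norm algebra_simps)
    moreover have "c + e \<in> cball c' r'" "c - e \<in> cball c' r'"
      using that assms(2,3) by auto
    ultimately have "norm (c - c' + e) \<le> r'" "norm (c - c' - e) \<le> r'"
      by (simp_all add: dist_commute)
    then have "(norm (c - c' + e))\<^sup>2 \<le> r'\<^sup>2" "(norm (c - c' - e))\<^sup>2 \<le> r'\<^sup>2"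
      by (simp_all add: power_mono)
    then have "(norm (c - c' + e))\<^sup>2 + (norm (c - c' - e))\<^sup>2 \<le> 2 * r'\<^sup>2"
      by simp
    moreover have "(norm (c - c' + e))\<^sup>2 + (norm (c - c' - e))\<^sup>2
        = 2 * ((norm (c - c'))\<^sup>2 + (norm e)\<^sup>2)"
      by (simp add: power2_norm_eq_inner inner_add_left inner_add_right inner_diff_left
          inner_diff_right inner_commute)
    ultimately show ?thesis by simp
  qed
  have smallest: "is_smallest_enclosing_ball S c (norm e)"
    unfolding is_smallest_enclosing_ball_def
  proof (intro conjI allI impI)
    fix c' r' assume "0 \<le> (r'::real)" "S \<subseteq> cball c' r'"
    then have "(norm e)\<^sup>2 \<le> r'\<^sup>2" using bound[of c' r'] by (smt (verit) zero_le_power2)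
    then show "norm e \<le> r'" using \<open>0 \<le> r'\<close> by (rule power2_le_imp_le)
  qed (use assms in auto)
  have unique: "c' = c \<and> r' = norm e" if "is_smallest_enclosing_ball S c' r'" for c' r'
  proof -
    have r': "0 \<le> r'" "S \<subseteq> cball c' r'" "r' \<le> norm e"
      using that assms(1) by (auto simp: is_smallest_enclosing_ball_def)
    have "(norm (c - c'))\<^sup>2 + (norm e)\<^sup>2 \<le> r'\<^sup>2" using bound r' by blast
    moreover have "r'\<^sup>2 \<le> (norm e)\<^sup>2" using r' by (simp add: power_mono)
    ultimately have "(norm (c - c'))\<^sup>2 \<le> 0" "r'\<^sup>2 = (norm e)\<^sup>2"
      by (smt (verit) zero_le_power2)+
    then show ?thesis using r' by simp
  qed
  show ?thesis
    unfolding smallest_enclosing_ball_def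
  proof (rule the_equality)
    fix p :: "'a \<times> real"
    obtain c' r' where p: "p = (c', r')" by (cases p)
    assume "case p of (c', r') \<Rightarrow> is_smallest_enclosing_ball S c' r'"
    then have "is_smallest_enclosing_ball S c' r'" by (simp add: p)
    from unique[OF this] show "p = (c, norm e)" by (simp only: p)
  qed (simp add: smallest)
qed

text \<open>The vector \<open>e\<close> of the antipodal pair must be orthogonal to the line of centers and have length
  \<open>r\<close>, where \<open>r\<^sup>2 = 2/\<alpha> (u - v)\<close>. In dimension at least two there is such a vector. If \<open>fst A = u\<close>,
  the sublevel set of \<open>Q\<^sub>A\<close> is a point; then \<open>v = u\<close>, because the weight one already attains \<open>u\<close>,
  and \<open>e = 0\<close>.\<close>

lemma smallest_enclosing_ball_optimal_averaging:
  fixes A B :: "real \<times> 'a::euclidean_space"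
  assumes "0 < \<alpha>" and "quad \<alpha> A p \<le> u" and "quad \<alpha> B p \<le> u"
    and dim: "2 \<le> DIM('a) \<or> fst A = u"
    and opt: "optimal_averaging \<alpha> A B = (v, c)"
  shows "v \<le> u"
    and "smallest_enclosing_ball ({y. quad \<alpha> A y \<le> u} \<inter> {y. quad \<alpha> B y \<le> u})
           = (c, sqrt (2 / \<alpha> * (u - v)))"
proof -
  obtain l where l: "v = avg_value \<alpha> A B l" "c = avg_center (snd A) (snd B) l"
    and max: "\<And>m. 0 \<le> m \<Longrightarrow> m \<le> 1 \<Longrightarrow> avg_value \<alpha> A B m \<le> v"
    and Qc: "quad \<alpha> A c \<le> v" "quad \<alpha> B c \<le> v"
    using optimal_averaging_saddle[OF assms(1), of A B] opt by (metis prod.inject)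
  have avg_ball: "v + \<alpha> / 2 * (norm (y - c))\<^sup>2 \<le> u" if "quad \<alpha> A y \<le> u" "quad \<alpha> B y \<le> u" for y
    using optimal_averaging_le[OF assms(1) that] by (simp add: opt quad_def)
  from avg_ball[OF assms(2,3)] show "v \<le> u"
    using assms(1) by (smt (verit) mult_nonneg_nonneg zero_le_power2 divide_nonneg_pos)
  define r where "r = sqrt (2 / \<alpha> * (u - v))"
  have r: "0 \<le> r" "v + \<alpha> / 2 * r\<^sup>2 = u"
    using assms(1) \<open>v \<le> u\<close> by (simp add: r_def, simp add: r_def field_simps)
  obtain e where e: "norm e = r" "(snd A - snd B) \<bullet> e = 0"
  proof (cases "fst A = u")
    case True
    moreover have "avg_value \<alpha> A B 1 = fst A" by (simp add: avg_value_def)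
    ultimately have "v = u" using max[of 1] \<open>v \<le> u\<close> by simp
    then show thesis using that[of 0] by (simp add: r_def)
  next
    case False
    then obtain w :: 'a where w: "w \<noteq> 0" "orthogonal (snd A - snd B) w"
      using dim orthogonal_to_vector_exists by blast
    show thesis
      by (rule that[of "(r / norm w) *\<^sub>R w"]) (use w r(1) in \<open>simp_all add: orthogonal_def\<close>)
  qed
  have "c - snd A = (l - 1) *\<^sub>R (snd A - snd B)" "c - snd B = l *\<^sub>R (snd A - snd B)"
    by (simp_all add: l avg_center_def algebra_simps)
  then have orth: "(c - snd A) \<bullet> e = 0" "(c - snd B) \<bullet> e = 0"
    using e by simp_all
  have shift: "quad \<alpha> Q (c + e') = quad \<alpha> Q c + \<alpha> / 2 * r\<^sup>2"
    if "(c - snd Q) \<bullet> e' = 0" "norm e' = r" for Q :: "real \<times> 'a" and e'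
  proof -
    have "(norm ((c - snd Q) + e'))\<^sup>2 = (norm (c - snd Q))\<^sup>2 + (norm e')\<^sup>2"
      using that by (intro norm_add_Pythagorean) (simp add: orthogonal_def)
    then have "(norm (c + e' - snd Q))\<^sup>2 = (norm (c - snd Q))\<^sup>2 + r\<^sup>2"
      using that by (simp only: add_diff_eq[symmetric] diff_add_eq)
    then show ?thesis by (simp add: quad_def ring_distribs)
  qed
  have "c + e' \<in> {y. quad \<alpha> A y \<le> u} \<inter> {y. quad \<alpha> B y \<le> u}" if "e' = e \<or> e' = - e" for e'
  proof -
    have "(c - snd A) \<bullet> e' = 0" "(c - snd B) \<bullet> e' = 0" "norm e' = r"
      using that orth e(1) by (elim disjE; simp)+
    then have "quad \<alpha> A (c + e') \<le> v + \<alpha> / 2 * r\<^sup>2" "quad \<alpha> B (c + e') \<le> v + \<alpha> / 2 * r\<^sup>2"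
      using shift[of A e'] shift[of B e'] Qc by simp_all
    then show ?thesis unfolding r(2) by blast
  qed
  from this[of e] this[of "- e"]
  have "c + e \<in> {y. quad \<alpha> A y \<le> u} \<inter> {y. quad \<alpha> B y \<le> u}"
    "c - e \<in> {y. quad \<alpha> A y \<le> u} \<inter> {y. quad \<alpha> B y \<le> u}"
    by simp_all
  moreover have "{y. quad \<alpha> A y \<le> u} \<inter> {y. quad \<alpha> B y \<le> u} \<subseteq> cball c (norm e)"
  proof
    fix y assume "y \<in> {y. quad \<alpha> A y \<le> u} \<inter> {y. quad \<alpha> B y \<le> u}"
    then have "v + \<alpha> / 2 * (norm (y - c))\<^sup>2 \<le> u" by (intro avg_ball) blast+
    then have "\<alpha> / 2 * (norm (y - c))\<^sup>2 \<le> \<alpha> / 2 * r\<^sup>2" using r(2) by linarith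
    then have "(norm (y - c))\<^sup>2 \<le> r\<^sup>2" using assms(1) by simp
    then have "norm (y - c) \<le> r" using r(1) by (rule power2_le_imp_le)
    then show "y \<in> cball c (norm e)" using e(1) by (simp add: dist_norm norm_minus_commute)
  qed
  ultimately have "smallest_enclosing_ball ({y. quad \<alpha> A y \<le> u} \<inter> {y. quad \<alpha> B y \<le> u}) = (c, norm e)"
    by (intro smallest_enclosing_ball_antipodal)
  then show "smallest_enclosing_ball ({y. quad \<alpha> A y \<le> u} \<inter> {y. quad \<alpha> B y \<le> u})
      = (c, sqrt (2 / \<alpha> * (u - v)))"
    by (simp add: e r_def)
qed

section \<open>Gradient steps and line search\<close>

lemma line_search_commute: "line_search f x y = line_search f y x"
proof -
  have "range (\<lambda>t::real. x + t *\<^sub>R (y - x)) \<subseteq> range (\<lambda>t. y + t *\<^sub>R (x - y))" for x y :: 'a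
  proof
    fix z assume "z \<in> range (\<lambda>t::real. x + t *\<^sub>R (y - x))"
    then obtain t :: real where "z = x + t *\<^sub>R (y - x)" by blast
    then have "z = y + (1 - t) *\<^sub>R (x - y)" by (simp add: algebra_simps)
    then show "z \<in> range (\<lambda>t. y + t *\<^sub>R (x - y))" by blast
  qed
  then have "range (\<lambda>t::real. x + t *\<^sub>R (y - x)) = range (\<lambda>t. y + t *\<^sub>R (x - y))"
    by (intro equalityI)
  then show ?thesis unfolding line_search_def by (rule arg_cong)
qed

context
  fixes f :: "'a::euclidean_space \<Rightarrow> real" and \<alpha> \<beta> :: real
  assumes \<alpha>: "0 < \<alpha>" and \<alpha>\<beta>: "\<alpha> \<le> \<beta>" and f: "smooth_strongly_convex \<beta> \<alpha> f"
begin

lemma strong_convexity: "f x + grad f x \<bullet> (y - x) + \<alpha> / 2 * (norm (y - x))\<^sup>2 \<le> f y"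
  and smoothness: "f y \<le> f x + grad f x \<bullet> (y - x) + \<beta> / 2 * (norm (y - x))\<^sup>2"
  using f unfolding smooth_strongly_convex_def by auto

text \<open>Completing the square: \<open>lower_quad f \<alpha> x\<close> represents the lower bound of strong convexity at \<open>x\<close>.\<close>

lemma lower_quad_le: "quad \<alpha> (lower_quad f \<alpha> x) y \<le> f y"
proof -
  have "quad \<alpha> (lower_quad f \<alpha> x) y = f x + grad f x \<bullet> (y - x) + \<alpha> / 2 * (norm (y - x))\<^sup>2"
  proof -
    have *: "y - long_step f \<alpha> x = (y - x) + (1 / \<alpha>) *\<^sub>R grad f x"
      by (simp add: long_step_def)
    have "(norm (y - long_step f \<alpha> x))\<^sup>2
        = (norm (y - x))\<^sup>2 + 2 / \<alpha> * (grad f x \<bullet> (y - x)) + (norm (grad f x))\<^sup>2 / \<alpha>\<^sup>2"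
      unfolding * power2_norm_eq_inner
      by (simp add: inner_add_left inner_add_right inner_commute power2_eq_square)
    then show ?thesis
      using \<alpha> by (simp add: quad_def lower_quad_def field_simps power2_eq_square)
  qed
  then show ?thesis using strong_convexity[of x y] by simp
qed

lemma short_step_descent: "f (short_step f \<beta> x) \<le> f x - (norm (grad f x))\<^sup>2 / (2 * \<beta>)"
proof -
  have "\<beta> / 2 * (norm (grad f x) / \<beta>)\<^sup>2 = (norm (grad f x))\<^sup>2 / \<beta> - (norm (grad f x))\<^sup>2 / (2 * \<beta>)"
    using \<alpha> \<alpha>\<beta> by (simp add: field_simps power2_eq_square)
  then show ?thesis
    using smoothness[of "short_step f \<beta> x" x] \<alpha> \<alpha>\<beta>
    by (simp add: short_step_def power2_norm_eq_inner[symmetric])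
qed

text \<open>Otherwise the short step would decrease \<open>f\<close>.\<close>

lemma minimizer_critical: "grad f x = 0" if "\<And>y. f x \<le> f y"
proof -
  have "(norm (grad f x))\<^sup>2 / (2 * \<beta>) \<le> 0"
    using short_step_descent[of x] that[of "short_step f \<beta> x"] by simp
  then show ?thesis using \<alpha> \<alpha>\<beta> by (simp add: divide_le_0_iff)
qed

lemma strict_minimizer: "f x < f y" if "grad f x = 0" "y \<noteq> x"
proof -
  have "0 < \<alpha> / 2 * (norm (y - x))\<^sup>2" using that \<alpha> by simp
  then show ?thesis using strong_convexity[of x y] that(1) by simp
qed

text \<open>Strong convexity makes \<open>f\<close> coercive: with \<open>g\<close> the gradient at \<open>a\<close>, the quadratic term exceeds
  the linear one at distance more than \<open>2/\<alpha> \<parallel>g\<parallel>\<close> from \<open>a\<close>. Hence it suffices to minimize over a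
  compact part of \<open>S\<close>.\<close>

lemma attains_min:
  assumes "closed S" and "S \<noteq> {}"
  obtains x where "x \<in> S" and "\<And>y. y \<in> S \<Longrightarrow> f x \<le> f y"
proof -
  obtain a where a: "a \<in> S" using assms by blast
  define r where "r = 2 / \<alpha> * norm (grad f a)"
  have far: "f a \<le> f y" if "r < norm (y - a)" for y
  proof -
    have "- (grad f a \<bullet> (y - a)) \<le> norm (grad f a) * norm (y - a)"
      using Cauchy_Schwarz_ineq2[of "grad f a" "y - a"] by linarith
    also have "\<dots> \<le> (\<alpha> / 2 * norm (y - a)) * norm (y - a)"
      using that \<alpha> by (intro mult_right_mono) (auto simp: r_def field_simps)
    finally show ?thesis
      using strong_convexity[of a y] by (simp add: power2_eq_square)
  qed
  have "continuous_on S' f" for S'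
    using f unfolding smooth_strongly_convex_def
    by (meson continuous_at_imp_continuous_on differentiable_imp_continuous_within)
  moreover have "compact (S \<inter> cball a r)" using assms(1) by (simp add: closed_Int_compact)
  moreover have "a \<in> S \<inter> cball a r" using a \<alpha> by (simp add: r_def)
  ultimately obtain x where x: "x \<in> S \<inter> cball a r" "\<And>y. y \<in> S \<inter> cball a r \<Longrightarrow> f x \<le> f y"
    using continuous_attains_inf[of "S \<inter> cball a r" f] by (metis empty_iff)
  show thesis
  proof (rule that)
    show "x \<in> S" using x by simp
    fix y assume "y \<in> S"
    show "f x \<le> f y"
    proof (cases "norm (y - a) \<le> r")
      case True
      then show ?thesis using x(2)[of y] \<open>y \<in> S\<close> by (simp add: dist_norm norm_minus_commute)
    next
      case False
      then show ?thesis
        using far[of y] x(2)[OF \<open>a \<in> S \<inter> cball a r\<close>] by simp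
    qed
  qed
qed

lemma line_search_minimizes: "f (line_search f x y) \<le> f (x + t *\<^sub>R (y - x))"
proof -
  let ?L = "range (\<lambda>t::real. x + t *\<^sub>R (y - x))"
  have "?L = (+) x ` span {y - x}" by (auto simp: span_singleton)
  then have "closed ?L" by (simp add: closed_translation)
  then obtain z where "z \<in> ?L" "\<And>y. y \<in> ?L \<Longrightarrow> f z \<le> f y" using attains_min by blast
  then have "is_arg_min f (\<lambda>z. z \<in> ?L) z" by (auto simp: is_arg_min_linorder)
  then have "is_arg_min f (\<lambda>z. z \<in> ?L) (line_search f x y)"
    unfolding line_search_def arg_min_on_def arg_min_def by (rule someI)
  then show ?thesis by (auto simp: is_arg_min_linorder)
qed

lemma line_search_critical:
  assumes "grad f y = 0"
  shows "line_search f x y = y"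
proof (rule ccontr)
  assume "line_search f x y \<noteq> y"
  then have "f y < f (line_search f x y)" by (rule strict_minimizer[OF assms])
  moreover have "f (line_search f x y) \<le> f y" using line_search_minimizes[of x y 1] by simp
  ultimately show False by simp
qed

lemma line_search_1D:
  assumes "DIM('a) = 1" and "x \<noteq> y"
  shows "grad f (line_search f x y) = 0"
proof (rule minimizer_critical)
  fix z
  have "dim {y - x} = DIM('a)" using assms by simp
  then have "span {y - x} = UNIV" by (simp only: dim_eq_full)
  then obtain t where "z - x = t *\<^sub>R (y - x)" by (metis UNIV_I rangeE span_singleton)
  then have "z = x + t *\<^sub>R (y - x)" by (simp add: algebra_simps)
  then show "f (line_search f x y) \<le> f z" using line_search_minimizes by blast
qed

text \<open>The two steps agree only if the gradient vanishes at \<open>x\<close> or \<open>\<alpha> = \<beta>\<close>. In both cases the value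
  guaranteed by the short step equals the minimum of the lower bound at \<open>x\<close>.\<close>

lemma equal_steps_critical:
  assumes "short_step f \<beta> x = long_step f \<alpha> x"
  shows "grad f (short_step f \<beta> x) = 0"
proof (rule minimizer_critical)
  fix y
  have "(1 / \<alpha> - 1 / \<beta>) *\<^sub>R grad f x = 0"
    using assms by (simp add: short_step_def long_step_def algebra_simps)
  then have "grad f x = 0 \<or> \<alpha> = \<beta>" using \<alpha> \<alpha>\<beta> by auto
  then have "f (short_step f \<beta> x) \<le> f x - (norm (grad f x))\<^sup>2 / (2 * \<alpha>)"
    using short_step_descent[of x] by auto
  also have "\<dots> \<le> quad \<alpha> (lower_quad f \<alpha> x) y"
    using \<alpha> by (simp add: quad_def lower_quad_def)
  also have "\<dots> \<le> f y" by (rule lower_quad_le)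
  finally show "f (short_step f \<beta> x) \<le> f y" .
qed

section \<open>Equivalence of the two algorithms\<close>

text \<open>On the line, the search is global as soon as its two points differ; if they coincide, the search
  set is a single point, which must then be known to be critical. Initially this is
  \<open>equal_steps_critical\<close>; afterwards a critical iterate is its own short step.\<close>

lemma oqa_critical_1D:
  assumes "DIM('a) = 1"
  shows "grad f (oqa_x f \<alpha> \<beta> x\<^sub>0 (Suc k)) = 0"
proof -
  have step: "grad f (oqa_x f \<alpha> \<beta> x\<^sub>0 (Suc k)) = 0"
    if "oqa_c f \<alpha> \<beta> x\<^sub>0 k = short_step f \<beta> (oqa_x f \<alpha> \<beta> x\<^sub>0 k)
        \<Longrightarrow> grad f (short_step f \<beta> (oqa_x f \<alpha> \<beta> x\<^sub>0 k)) = 0" for k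
  proof -
    have "oqa_x f \<alpha> \<beta> x\<^sub>0 (Suc k)
        = line_search f (oqa_c f \<alpha> \<beta> x\<^sub>0 k) (short_step f \<beta> (oqa_x f \<alpha> \<beta> x\<^sub>0 k))"
      by (simp add: oqa_x_def oqa_c_def Let_def split: prod.split)
    then show ?thesis
      using that line_search_1D[OF assms] line_search_critical by metis
  qed
  show ?thesis
  proof (induction k)
    case 0
    show ?case
      using equal_steps_critical[of x\<^sub>0]
      by (intro step) (simp add: oqa_x_def oqa_c_def lower_quad_def)
  next
    case (Suc k)
    then show ?case by (intro step) (simp add: short_step_def)
  qed
qed

lemma oqa_quad_le: "quad \<alpha> (snd (oqa f \<alpha> \<beta> x\<^sub>0 k)) y \<le> f y"
proof (induction k)
  case 0
  then show ?case by (simp add: lower_quad_le)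
next
  case (Suc k)
  then show ?case
    by (auto simp: Let_def split: prod.split intro!: optimal_averaging_le \<alpha> lower_quad_le)
qed

text \<open>The first ball of a geometric descent step is the sublevel set of the new quadratic at the height
  \<open>f x\<^sup>+\<close>.\<close>

lemma gd_sq_radius_eq:
  "gd_sq_radius f \<alpha> \<beta> x = 2 / \<alpha> * (f (short_step f \<beta> x) - fst (lower_quad f \<alpha> x))"
  using \<alpha> by (simp add: gd_sq_radius_def lower_quad_def field_simps power2_eq_square)

text \<open>In the induction, the radius \<open>R\<close> is known through its square. The value of \<open>v\<close> turns
  \<open>R\<^sup>2 - 2/\<alpha> (f x\<^sup>+ - u)\<close> into \<open>2/\<alpha> (u - v)\<close>, so that the second ball is the sublevel set of the
  old quadratic at the new height \<open>u\<close>.\<close>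

lemma oqa_eq_geometric_descent:
  obtains x v c R where "oqa f \<alpha> \<beta> x\<^sub>0 k = (x, v, c)"
    and "geometric_descent f \<alpha> \<beta> x\<^sub>0 k = (x, c, R)"
    and "v = f (short_step f \<beta> x) - \<alpha> / 2 * R\<^sup>2"
proof -
  have "\<exists>x v c R. oqa f \<alpha> \<beta> x\<^sub>0 k = (x, v, c) \<and> geometric_descent f \<alpha> \<beta> x\<^sub>0 k = (x, c, R)
      \<and> v = f (short_step f \<beta> x) - \<alpha> / 2 * R\<^sup>2"
  proof (induction k)
    case 0
    \<comment> \<open>The initial squared radius is nonnegative, so that squaring its root returns it.\<close>
    have "fst (lower_quad f \<alpha> x\<^sub>0) \<le> quad \<alpha> (lower_quad f \<alpha> x\<^sub>0) (short_step f \<beta> x\<^sub>0)"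
      using \<alpha> by (simp add: quad_def)
    also have "\<dots> \<le> f (short_step f \<beta> x\<^sub>0)" by (rule lower_quad_le)
    finally have "\<alpha> / 2 * (sqrt (gd_sq_radius f \<alpha> \<beta> x\<^sub>0))\<^sup>2
        = f (short_step f \<beta> x\<^sub>0) - fst (lower_quad f \<alpha> x\<^sub>0)"
      using \<alpha> by (simp add: gd_sq_radius_eq)
    then have "fst (lower_quad f \<alpha> x\<^sub>0)
        = f (short_step f \<beta> x\<^sub>0) - \<alpha> / 2 * (sqrt (gd_sq_radius f \<alpha> \<beta> x\<^sub>0))\<^sup>2"
      by linarith
    moreover have "lower_quad f \<alpha> x\<^sub>0 = (fst (lower_quad f \<alpha> x\<^sub>0), long_step f \<alpha> x\<^sub>0)"
      by (simp add: lower_quad_def)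
    ultimately show ?case
      by (metis oqa.simps(1) geometric_descent.simps(1))
  next
    case (Suc k)
    then obtain x v c R where IH: "oqa f \<alpha> \<beta> x\<^sub>0 k = (x, v, c)"
      "geometric_descent f \<alpha> \<beta> x\<^sub>0 k = (x, c, R)"
      and v: "v = f (short_step f \<beta> x) - \<alpha> / 2 * R\<^sup>2" by blast
    define x' where "x' = line_search f c (short_step f \<beta> x)"
    define u where "u = f (short_step f \<beta> x')"
    define A where "A = lower_quad f \<alpha> x'"
    obtain v' c' where opt: "optimal_averaging \<alpha> A (v, c) = (v', c')" by force
    have oqa': "oqa f \<alpha> \<beta> x\<^sub>0 (Suc k) = (x', v', c')"
      using opt by (simp add: IH x'_def A_def Let_def)
    have balls: "{y. quad \<alpha> A y \<le> u} = sq_ball (long_step f \<alpha> x') (gd_sq_radius f \<alpha> \<beta> x')"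
      "{y. quad \<alpha> (v, c) y \<le> u} = sq_ball c (R\<^sup>2 - 2 / \<alpha> * (f (short_step f \<beta> x) - u))"
    proof -
      have "2 / \<alpha> * (u - v) = R\<^sup>2 - 2 / \<alpha> * (f (short_step f \<beta> x) - u)"
        using \<alpha> by (simp add: v field_simps)
      then show "{y. quad \<alpha> A y \<le> u} = sq_ball (long_step f \<alpha> x') (gd_sq_radius f \<alpha> \<beta> x')"
        "{y. quad \<alpha> (v, c) y \<le> u} = sq_ball c (R\<^sup>2 - 2 / \<alpha> * (f (short_step f \<beta> x) - u))"
        by (simp_all add: quad_sublevel[OF \<alpha>] gd_sq_radius_eq A_def u_def)
          (simp add: lower_quad_def)
    qed
    have "2 \<le> DIM('a) \<or> fst A = u"
    proof (cases "DIM('a) = 1")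
      case True
      then have "grad f x' = 0" using oqa_critical_1D[of x\<^sub>0 k] oqa' by (simp add: oqa_x_def)
      then show ?thesis by (simp add: A_def u_def lower_quad_def short_step_def)
    next
      case False
      moreover have "0 < DIM('a)" by (rule DIM_positive)
      ultimately show ?thesis by linarith
    qed
    moreover have "quad \<alpha> A (short_step f \<beta> x') \<le> u" "quad \<alpha> (v, c) (short_step f \<beta> x') \<le> u"
      using lower_quad_le oqa_quad_le[of x\<^sub>0 k] by (simp_all add: A_def u_def IH)
    ultimately have "v' \<le> u"
      and seb: "smallest_enclosing_ball ({y. quad \<alpha> A y \<le> u} \<inter> {y. quad \<alpha> (v, c) y \<le> u})
        = (c', sqrt (2 / \<alpha> * (u - v')))"
      using smallest_enclosing_ball_optimal_averaging \<alpha> opt by blast+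
    have "geometric_descent f \<alpha> \<beta> x\<^sub>0 (Suc k) = (x', c', sqrt (2 / \<alpha> * (u - v')))"
      using seb[unfolded balls]
      by (simp add: IH Let_def line_search_commute[of f "short_step f \<beta> x" c] x'_def u_def)
    moreover have "v' = u - \<alpha> / 2 * (sqrt (2 / \<alpha> * (u - v')))\<^sup>2"
      using \<alpha> \<open>v' \<le> u\<close> by (simp add: field_simps)
    ultimately show ?case using oqa' unfolding u_def by blast
  qed
  then show thesis using that by blast
qed

end

theorem theorem4p5:
  fixes f :: "real ^ 'n \<Rightarrow> real" and \<alpha> \<beta> :: real and x\<^sub>0 :: "real ^ 'n"
  assumes "0 < \<alpha>" and "\<alpha> \<le> \<beta>"
    and "smooth_strongly_convex \<beta> \<alpha> f"
  shows "\<forall>k. oqa_x f \<alpha> \<beta> x\<^sub>0 k = gd_x f \<alpha> \<beta> x\<^sub>0 k \<and>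
             oqa_c f \<alpha> \<beta> x\<^sub>0 k = gd_c f \<alpha> \<beta> x\<^sub>0 k \<and>
             oqa_v f \<alpha> \<beta> x\<^sub>0 k =
               f (short_step f \<beta> (gd_x f \<alpha> \<beta> x\<^sub>0 k)) - \<alpha> / 2 * (gd_R f \<alpha> \<beta> x\<^sub>0 k)\<^sup>2"
proof
  fix k
  obtain x v c R where "oqa f \<alpha> \<beta> x\<^sub>0 k = (x, v, c)" "geometric_descent f \<alpha> \<beta> x\<^sub>0 k = (x, c, R)"
    "v = f (short_step f \<beta> x) - \<alpha> / 2 * R\<^sup>2"
    by (rule oqa_eq_geometric_descent[OF assms])
  then show "oqa_x f \<alpha> \<beta> x\<^sub>0 k = gd_x f \<alpha> \<beta> x\<^sub>0 k \<and>
             oqa_c f \<alpha> \<beta> x\<^sub>0 k = gd_c f \<alpha> \<beta> x\<^sub>0 k \<and>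
             oqa_v f \<alpha> \<beta> x\<^sub>0 k =
               f (short_step f \<beta> (gd_x f \<alpha> \<beta> x\<^sub>0 k)) - \<alpha> / 2 * (gd_R f \<alpha> \<beta> x\<^sub>0 k)\<^sup>2"
    by (simp add: oqa_x_def oqa_c_def oqa_v_def gd_x_def gd_c_def gd_R_def)
qed

end
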